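(* (a) There is a (total) multi-valued function $F:\mathcal{C}\Rightarrow\mathcal{N}$ such that $F(x)$ is a closed subset of $\mathcal{N}$ for all $x\in\mathcal{C}$, the graph of $F$ is a Borel subset of $\mathcal{C}\times\mathcal{N}$, and the set of points of continuity of $F$ is analytic but not Borel. (b) There is a (total) multi-valued function $F:[0,1]\Rightarrow[0,1]$ whose graph is a Borel subset of $[0,1]\times[0,1]$ and whose set of points of continuity is analytic but not Borel.
   Context: $\mathcal{N}=\omega^\omega$ is the Baire space with metric $d_{\mathcal{N}}(\alpha,\beta)=1/(n+1)$ where $n$ is least with $\alpha(n)\neq\beta(n)$ (and $0$ if $\alpha=\beta$); $\mathcal{C}=2^\omega\subseteq\mathcal{N}$ is the Cantor space with the induced metric. A multi-valued function $F: X \Rightarrow Y$ assigns to each $x$ a nonempty subset $F(x)\subseteq Y$ and is identified with its graph $\{(x,y):y\in F(x)\}$. $F$ is continuous at $x$ if there is some $y\in F(x)$ such that for every $\varepsilon>0$ there is $\delta>0$ such that for every $x'$ within distance $\delta$ of $x$ there is $y'\in F(x')$ within distance $\varepsilon$ of $y$. A set is analytic if it is a continuous image of a closed subset of a complete separable metric space. *)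

theory Defs
  imports "HOL-Analysis.Analysis"
begin

definition baire_dist :: "(nat \<Rightarrow> nat) \<Rightarrow> (nat \<Rightarrow> nat) \<Rightarrow> real" where
  "baire_dist \<alpha> \<beta> =
     (if \<alpha> = \<beta> then 0 else 1 / (real (LEAST n. \<alpha> n \<noteq> \<beta> n) + 1))"

lemma Metric_space_baire_dist: "Metric_space UNIV baire_dist"
proof
  fix a b c :: "nat \<Rightarrow> nat"
  show "0 \<le> baire_dist a b"
    by (simp add: baire_dist_def)
  show "baire_dist a b = baire_dist b a"
    unfolding baire_dist_def by (simp add: eq_commute)
  show "baire_dist a b = 0 \<longleftrightarrow> a = b"
    unfolding baire_dist_def by (simp add: add_nonneg_eq_0_iff)
  show "baire_dist a c \<le> baire_dist a b + baire_dist b c"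
  proof (cases "a = b \<or> b = c \<or> a = c")
    case True
    then show ?thesis
      by (auto simp: baire_dist_def)
  next
    case False
    define k where "k = (LEAST n. a n \<noteq> c n)"
    have ac: "baire_dist a c = 1 / (real k + 1)"
      using False by (simp add: baire_dist_def k_def)
    have "\<exists>n. a n \<noteq> c n"
      using False by blast
    then have "a k \<noteq> c k"
      unfolding k_def by (rule LeastI_ex)
    then consider "a k \<noteq> b k" | "b k \<noteq> c k"
      by metis
    then show ?thesis
    proof cases
      case 1
      then have "(LEAST n. a n \<noteq> b n) \<le> k"
        by (rule Least_le)
      then have "1 / (real k + 1) \<le> baire_dist a b"
        using False by (simp add: baire_dist_def frac_le)
      moreover have "0 \<le> baire_dist b c"
        by (simp add: baire_dist_def)
      ultimately show ?thesis
        using ac by linarith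
    next
      case 2
      then have "(LEAST n. b n \<noteq> c n) \<le> k"
        by (rule Least_le)
      then have "1 / (real k + 1) \<le> baire_dist b c"
        using False by (simp add: baire_dist_def frac_le)
      moreover have "0 \<le> baire_dist a b"
        by (simp add: baire_dist_def)
      ultimately show ?thesis
        using ac by linarith
    qed
  qed
qed

definition baire_space :: "(nat \<Rightarrow> nat) metric" where
  "baire_space = metric (UNIV, baire_dist)"

lemma mspace_baire_space [simp]: "mspace baire_space = UNIV"
  and mdist_baire_space [simp]: "mdist baire_space = baire_dist"
  by (simp_all add: baire_space_def Metric_space.mspace_metric
        Metric_space.mdist_metric Metric_space_baire_dist)

definition cantor_space :: "(nat \<Rightarrow> nat) metric" where
  "cantor_space = submetric baire_space {\<alpha>. \<forall>n. \<alpha> n \<in> {0, 1}}"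

definition unit_interval :: "real metric" where
  "unit_interval = submetric euclidean_metric {0..1}"

(* The library's class-based "borel" does not apply to topologies with a proper carrier. *)
definition borel_in :: "'a topology \<Rightarrow> 'a set \<Rightarrow> bool" where
  "borel_in T A \<longleftrightarrow> A \<in> sigma_sets (topspace T) {U. openin T U}"

(* HOL cannot quantify existentially over types. Letting the complete separable space Z range over
   the metric spaces whose carrier is a set of functions nat => nat loses nothing: a separable
   metric space has at most continuum many points, so it is isometric to one of these. *)
definition analytic_in :: "'a topology \<Rightarrow> 'a set \<Rightarrow> bool" where
  "analytic_in T A \<longleftrightarrow>
     (\<exists>(Z :: (nat \<Rightarrow> nat) metric) S f.
        mcomplete_of Z \<and> separable_space (mtopology_of Z) \<and>
        closedin (mtopology_of Z) S \<and>
        continuous_map (subtopology (mtopology_of Z) S) T f \<and> f ` S = A)"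

(* Values of F outside mspace X are irrelevant: every notion below only inspects F on mspace X. *)
definition multifunction :: "'a metric \<Rightarrow> 'b metric \<Rightarrow> ('a \<Rightarrow> 'b set) \<Rightarrow> bool" where
  "multifunction X Y F \<longleftrightarrow> (\<forall>x\<in>mspace X. F x \<noteq> {} \<and> F x \<subseteq> mspace Y)"

definition graph_of :: "'a metric \<Rightarrow> ('a \<Rightarrow> 'b set) \<Rightarrow> ('a \<times> 'b) set" where
  "graph_of X F = {(x, y). x \<in> mspace X \<and> y \<in> F x}"

definition multi_continuous_at ::
    "'a metric \<Rightarrow> 'b metric \<Rightarrow> ('a \<Rightarrow> 'b set) \<Rightarrow> 'a \<Rightarrow> bool" where
  "multi_continuous_at X Y F x \<longleftrightarrow>
     (\<exists>y\<in>F x. \<forall>\<epsilon>>0. \<exists>\<delta>>0. \<forall>x'\<in>mspace X.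
        mdist X x x' < \<delta> \<longrightarrow> (\<exists>y'\<in>F x'. mdist Y y y' < \<epsilon>))"

definition continuity_points :: "'a metric \<Rightarrow> 'b metric \<Rightarrow> ('a \<Rightarrow> 'b set) \<Rightarrow> 'a set" where
  "continuity_points X Y F = {x \<in> mspace X. multi_continuous_at X Y F x}"

end

theory Submission
  imports Defs
begin

text \<open>Let \<open>A\<close> be a non-Borel set of the form \<open>{x. \<exists>y. (x, y) \<in> P}\<close> with \<open>P\<close> closed.  The values of the
  multifunction at \<open>x\<close> are the branches through the section of \<open>P\<close> at \<open>x\<close>, together with
  the finite sequences in the corresponding tree, each ended by \<open>0\<close> and followed by a mark which
  takes two values on two complementary dense sets of arguments \<open>x\<close>.  A marked finite sequence is
  never a witness of continuity, because arbitrarily close arguments carry the other mark.  An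
  infinite branch always is one, because finite parts of the tree depend only on finitely many
  entries of \<open>x\<close>, so the initial segments of the branch occur, marked, at all nearby arguments.
  Hence \<open>A\<close> is the set of points of continuity.  On the unit interval the values need not be
  closed, so all marked sequences may be admitted at every argument, and the Baire space is
  embedded into the line.\<close>

section \<open>The topology of the Baire space\<close>

text \<open>A first difference at \<open>k\<close> means distance \<open>1/(k+1)\<close>, which is
  below \<open>1/(n+1)\<close> exactly if \<open>k\<close> exceeds \<open>n\<close>; hence index
  \<open>n\<close> is included. Metric conditions thereby become conditions on initial
  segments.\<close>

lemma baire_dist_less_iff:
  "baire_dist x y < 1 / real (Suc n) \<longleftrightarrow> (\<forall>i\<le>n. x i = y i)"
proof (cases "x = y")
  case True
  then show ?thesis by (simp add: baire_dist_def)
next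
  case False
  define k where "k = (LEAST n. x n \<noteq> y n)"
  have "\<exists>n. x n \<noteq> y n" using False by auto
  then have "x k \<noteq> y k" unfolding k_def by (rule LeastI_ex)
  moreover have "x i = y i" if "i < k" for i
    using not_less_Least[OF that[unfolded k_def]] by simp
  ultimately have k: "x k \<noteq> y k" "\<And>i. i < k \<Longrightarrow> x i = y i" by blast+
  have "baire_dist x y < 1 / real (Suc n) \<longleftrightarrow> n < k"
    using False by (simp add: baire_dist_def k_def[symmetric] field_simps)
  also have "\<dots> \<longleftrightarrow> (\<forall>i\<le>n. x i = y i)"
    using k by (meson le_less_trans not_le)
  finally show ?thesis .
qed

text \<open>\<open>open\<close> here is the product topology of discrete factors; a basic box
  restricts finitely many coordinates, all below some \<open>n\<close>.\<close>

lemma open_baire_iff: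
  fixes U :: "(nat \<Rightarrow> nat) set"
  shows "open U \<longleftrightarrow> (\<forall>x\<in>U. \<exists>n. \<forall>y. (\<forall>i<n. y i = x i) \<longrightarrow> y \<in> U)"
    (is "_ \<longleftrightarrow> ?R")
proof
  assume "open U"
  show ?R
  proof
    fix x assume "x \<in> U"
    with \<open>open U\<close> obtain V :: "nat \<Rightarrow> nat set" where V: "finite {i. V i \<noteq> UNIV}"
      "\<And>i. x i \<in> V i" "Pi\<^sub>E UNIV V \<subseteq> U"
      unfolding open_fun_def openin_product_topology_alt by force
    from V(1) obtain n where n: "\<And>i. V i \<noteq> UNIV \<Longrightarrow> i < n"
      unfolding finite_nat_set_iff_bounded by auto
    have "y \<in> U" if "\<forall>i<n. y i = x i" for y
    proof -
      have "y i \<in> V i" for i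
        using that n[of i] V(2)[of i] by (cases "i < n") auto
      then show ?thesis using V(3) by auto
    qed
    then show "\<exists>n. \<forall>y. (\<forall>i<n. y i = x i) \<longrightarrow> y \<in> U" by blast
  qed
next
  assume R: ?R
  show "open U"
    unfolding open_fun_def openin_product_topology_alt
  proof
    fix x assume "x \<in> U"
    with R obtain n where n: "\<And>y. (\<forall>i<n. y i = x i) \<Longrightarrow> y \<in> U" by blast
    show "\<exists>V. finite {i \<in> UNIV. V i \<noteq> topspace euclidean} \<and>
        (\<forall>i\<in>UNIV. openin euclidean (V i)) \<and> x \<in> Pi\<^sub>E UNIV V \<and> Pi\<^sub>E UNIV V \<subseteq> U"
    proof (intro exI[of _ "\<lambda>i. if i < n then {x i} else UNIV"] conjI)
      show "finite {i \<in> UNIV. (if i < n then {x i} else UNIV) \<noteq> topspace euclidean}"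
        by (rule finite_subset[of _ "{..<n}"]) auto
      show "Pi\<^sub>E UNIV (\<lambda>i. if i < n then {x i} else UNIV) \<subseteq> U"
      proof
        fix y assume "y \<in> Pi\<^sub>E UNIV (\<lambda>i. if i < n then {x i} else UNIV)"
        then have "y i \<in> (if i < n then {x i} else UNIV)" for i by (rule PiE_mem) simp
        then have "\<forall>i<n. y i = x i" by (metis singletonD)
        then show "y \<in> U" by (rule n)
      qed
    qed (auto simp: open_discrete)
  qed
qed

lemma closed_baire_local:
  fixes S :: "(nat \<Rightarrow> nat) set"
  assumes "\<And>x y. (\<forall>i<n. x i = y i) \<Longrightarrow> x \<in> S \<Longrightarrow> y \<in> S"
  shows "closed S"
  unfolding closed_def open_baire_iff
proof
  fix x assume "x \<in> - S"
  then show "\<exists>n. \<forall>y. (\<forall>i<n. y i = x i) \<longrightarrow> y \<in> - S"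
    using assms by (intro exI[of _ n]) blast
qed

text \<open>Balls and cylinders refine each other. The identification makes \<open>open\<close>,
  \<open>closed\<close> and \<open>borel\<close> of the type classes available.\<close>

lemma mtopology_of_baire_space [simp]: "mtopology_of baire_space = euclidean"
proof -
  interpret Metric_space UNIV baire_dist by (rule Metric_space_baire_dist)
  have "openin mtopology U \<longleftrightarrow> open U" for U
  proof -
    have "(\<exists>r>0. mball x r \<subseteq> U) \<longleftrightarrow> (\<exists>n. \<forall>y. (\<forall>i<n. y i = x i) \<longrightarrow> y \<in> U)" for x
    proof
      assume "\<exists>r>0. mball x r \<subseteq> U"
      then obtain r where r: "r > 0" "mball x r \<subseteq> U" by blast
      then obtain n where n: "1 / real (Suc n) < r"
        using reals_Archimedean[of r] by (auto simp: inverse_eq_divide)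
      have "y \<in> U" if "\<forall>i<Suc n. y i = x i" for y
      proof -
        have "baire_dist x y < 1 / real (Suc n)"
          unfolding baire_dist_less_iff using that by auto
        then show ?thesis using n r by (auto simp: in_mball)
      qed
      then show "\<exists>n. \<forall>y. (\<forall>i<n. y i = x i) \<longrightarrow> y \<in> U" by blast
    next
      assume "\<exists>n. \<forall>y. (\<forall>i<n. y i = x i) \<longrightarrow> y \<in> U"
      then obtain n where n: "\<And>y. (\<forall>i<n. y i = x i) \<Longrightarrow> y \<in> U" by blast
      have "mball x (1 / real (Suc n)) \<subseteq> U"
        using n by (auto simp: in_mball baire_dist_less_iff simp del: of_nat_Suc)
      then show "\<exists>r>0. mball x r \<subseteq> U"
        by (intro exI[of _ "1 / real (Suc n)"]) auto
    qed
    then show ?thesis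
      unfolding openin_mtopology open_baire_iff by auto
  qed
  then show ?thesis
    by (simp add: mtopology_of_def topology_eq)
qed

abbreviation cantor :: "(nat \<Rightarrow> nat) set" where
  "cantor \<equiv> {\<alpha>. \<forall>n. \<alpha> n \<in> {0, 1}}"

lemma mtopology_of_cantor_space: "mtopology_of cantor_space = top_of_set cantor"
  by (simp add: cantor_space_def mtopology_of_submetric)

lemma mspace_cantor_space: "mspace cantor_space = cantor"
  by (simp add: cantor_space_def)

lemma mdist_cantor_space: "mdist cantor_space = baire_dist"
  by (simp add: cantor_space_def)

lemma mtopology_of_unit_interval: "mtopology_of unit_interval = top_of_set {0..1}"
  by (simp add: unit_interval_def mtopology_of_submetric)

lemma mspace_unit_interval: "mspace unit_interval = {0..1}"
  by (simp add: unit_interval_def)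

lemma mdist_unit_interval: "mdist unit_interval = dist"
  by (simp add: unit_interval_def)

lemma mcomplete_of_baire_space: "mcomplete_of baire_space"
proof -
  interpret Metric_space UNIV baire_dist by (rule Metric_space_baire_dist)
  have "\<exists>x. limitin mtopology \<sigma> x sequentially" if "MCauchy \<sigma>" for \<sigma>
  proof -
    have "\<exists>N. \<forall>n m. N \<le> n \<longrightarrow> N \<le> m \<longrightarrow> baire_dist (\<sigma> n) (\<sigma> m) < 1 / real (Suc k)" for k
      using that unfolding MCauchy_def by (metis of_nat_0_less_iff zero_less_Suc zero_less_divide_1_iff)
    then obtain N where N: "\<And>k n m i. N k \<le> n \<Longrightarrow> N k \<le> m \<Longrightarrow> i \<le> k \<Longrightarrow> \<sigma> n i = \<sigma> m i"
      unfolding baire_dist_less_iff by metis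
    \<comment> \<open>Coordinate \<open>i\<close> is constant along the sequence from
      \<open>N i\<close> on.\<close>
    define x where "x i = \<sigma> (N i) i" for i
    have "eventually (\<lambda>n. \<sigma> n \<in> U) sequentially" if "open U" "x \<in> U" for U
    proof -
      obtain k where k: "\<And>y. (\<forall>i<k. y i = x i) \<Longrightarrow> y \<in> U"
        using \<open>open U\<close> \<open>x \<in> U\<close> unfolding open_baire_iff by blast
      have "\<sigma> n \<in> U" if "n \<ge> Max (N ` {..k})" for n
      proof (rule k, intro allI impI)
        fix i assume "i < k"
        then have "N i \<le> n" using that by (auto simp: Max_ge_iff)
        then show "\<sigma> n i = x i" unfolding x_def using N[of i n "N i" i] by simp
      qed
      then show ?thesis unfolding eventually_sequentially by blast
    qed
    moreover have "mtopology = euclidean"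
      using mtopology_of_baire_space by (simp add: mtopology_of_def)
    ultimately have "limitin mtopology \<sigma> x sequentially"
      by (simp add: limitin_def)
    then show ?thesis by blast
  qed
  then show ?thesis by (simp add: mcomplete_of_def mcomplete_def)
qed

lemma separable_space_baire_space: "separable_space (mtopology_of baire_space)"
proof -
  obtain D :: "(nat \<Rightarrow> nat) set" where D: "countable D"
    "\<And>X. open X \<Longrightarrow> X \<noteq> {} \<Longrightarrow> \<exists>d\<in>D. d \<in> X"
    using countable_dense_exists by blast
  have "closure D = UNIV"
    using D(2)[of "- closure D"] closure_subset[of D] by auto
  with D(1) show ?thesis
    unfolding separable_space_def by (auto intro!: exI[of _ D])
qed

text \<open>The Baire space, complete and separable, serves as the space \<open>Z\<close> of the
  definition.\<close>

lemma analytic_in_imageI: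
  fixes S :: "(nat \<Rightarrow> nat) set" and f :: "(nat \<Rightarrow> nat) \<Rightarrow> 'a::topological_space"
  assumes "closed S" "continuous_on S f" "f ` S = A" "A \<subseteq> X"
  shows "analytic_in (top_of_set X) A"
  unfolding analytic_in_def
proof (intro exI conjI)
  show "closedin (mtopology_of baire_space) S"
    using assms(1) by simp
  show "continuous_map (subtopology (mtopology_of baire_space) S) (top_of_set X) f"
    using assms by (auto simp: continuous_map_in_subtopology)
qed (use assms mcomplete_of_baire_space separable_space_baire_space in auto)

text \<open>The generated sigma-algebra consists of the traces of Borel sets on \<open>X\<close>; as
  \<open>X\<close> is closed, these are themselves Borel in the whole space.\<close>

lemma borel_in_top_of_set_iff:
  assumes "closed X"
  shows "borel_in (top_of_set X) A \<longleftrightarrow> A \<subseteq> X \<and> A \<in> sets borel"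
proof -
  have "{U. openin (top_of_set X) U} = (\<inter>) X ` {S. open S}"
    by (auto simp: openin_open)
  then have "sigma_sets (topspace (top_of_set X)) {U. openin (top_of_set X) U} = (\<inter>) X ` sets borel"
    using sigma_sets_Int[of X UNIV "{S. open S}"] assms borel_closed[OF assms]
    by (simp add: borel_def)
  also have "\<dots> = {A. A \<subseteq> X \<and> A \<in> sets borel}"
    using borel_closed[OF assms] by blast
  finally show ?thesis by (simp add: borel_in_def)
qed

section \<open>A non-Borel projection of a closed set\<close>

lemma open_baire_pair_iff:
  fixes W :: "((nat \<Rightarrow> nat) \<times> (nat \<Rightarrow> nat)) set"
  shows "open W \<longleftrightarrow> (\<forall>x y. (x, y) \<in> W \<longrightarrow>
    (\<exists>n. \<forall>x' y'. (\<forall>i<n. x' i = x i \<and> y' i = y i) \<longrightarrow> (x', y') \<in> W))"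
    (is "_ \<longleftrightarrow> ?R")
proof
  assume W: "open W"
  show ?R
  proof (intro allI impI)
    fix x y assume "(x, y) \<in> W"
    then obtain A B where AB: "open A" "open B" "x \<in> A" "y \<in> B" "A \<times> B \<subseteq> W"
      using W by (auto elim: open_prod_elim)
    obtain n where n: "\<And>x'. (\<forall>i<n. x' i = x i) \<Longrightarrow> x' \<in> A"
      using AB unfolding open_baire_iff by blast
    obtain m where m: "\<And>y'. (\<forall>i<m. y' i = y i) \<Longrightarrow> y' \<in> B"
      using AB unfolding open_baire_iff by blast
    show "\<exists>n. \<forall>x' y'. (\<forall>i<n. x' i = x i \<and> y' i = y i) \<longrightarrow> (x', y') \<in> W"
      using n m AB(5) by (intro exI[of _ "max n m"]) (auto intro!: subsetD[OF AB(5)])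
  qed
next
  assume R: ?R
  show "open W"
  proof (rule open_prod_intro)
    fix p assume "p \<in> W"
    obtain x y where p: "p = (x, y)" by (cases p)
    with R \<open>p \<in> W\<close> obtain n
      where n: "\<And>x' y'. (\<forall>i<n. x' i = x i \<and> y' i = y i) \<Longrightarrow> (x', y') \<in> W" by blast
    have "open {z. \<forall>i<n. z i = w i}" for w :: "nat \<Rightarrow> nat"
      unfolding open_baire_iff by (auto intro!: exI[of _ n])
    then show "\<exists>A B. open A \<and> open B \<and> p \<in> A \<times> B \<and> A \<times> B \<subseteq> W"
      using n p by (intro exI[of _ "{z. \<forall>i<n. z i = x i}"] exI[of _ "{z. \<forall>i<n. z i = y i}"]) auto
  qed
qed

lemma clopen_baire_pairI:
  fixes W :: "((nat \<Rightarrow> nat) \<times> (nat \<Rightarrow> nat)) set"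
  assumes "\<And>x y. \<exists>n. \<forall>x' y'. (\<forall>i<n. x' i = x i \<and> y' i = y i) \<longrightarrow> ((x', y') \<in> W \<longleftrightarrow> (x, y) \<in> W)"
  shows "open W" "closed W"
proof -
  have "open V" if V: "V = W \<or> V = - W" for V
    unfolding open_baire_pair_iff
  proof (intro allI impI)
    fix x y assume "(x, y) \<in> V"
    moreover obtain n where
      "\<And>x' y'. (\<forall>i<n. x' i = x i \<and> y' i = y i) \<Longrightarrow> (x', y') \<in> W \<longleftrightarrow> (x, y) \<in> W"
      using assms[of x y] by blast
    ultimately show "\<exists>n. \<forall>x' y'. (\<forall>i<n. x' i = x i \<and> y' i = y i) \<longrightarrow> (x', y') \<in> V"
      using V by (intro exI[of _ n]) auto
  qed
  then show "open W" "closed W" by (auto simp: closed_def)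
qed

section \<open>Analytic sets as projections of closed sets\<close>

definition souslin :: "(nat \<Rightarrow> nat) set \<Rightarrow> bool" where
  "souslin B \<longleftrightarrow> (\<exists>Q. closed Q \<and> B = {x. \<exists>y :: nat \<Rightarrow> nat. (x, y) \<in> Q})"

text \<open>The first entry of a witness names the index \<open>i\<close>; the shifted remainder is
  a witness for \<open>B i\<close>.\<close>

lemma souslin_Union:
  assumes "\<And>i::nat. souslin (B i)"
  shows "souslin (\<Union>i. B i)"
proof -
  obtain Q where Q: "\<And>i. closed (Q i)" "\<And>i. B i = {x. \<exists>y :: nat \<Rightarrow> nat. (x, y) \<in> Q i}"
    using assms unfolding souslin_def by metis
  \<comment> \<open>Stated as implications, one for each possible first entry, so that the
    combination is an intersection and stays closed.\<close>
  define R where "R = (\<Inter>i. {p. snd p 0 \<noteq> i} \<union> (\<lambda>p. (fst p, \<lambda>j. snd p (Suc j))) -` Q i)"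
  have "closed {p :: (nat \<Rightarrow> nat) \<times> (nat \<Rightarrow> nat). snd p 0 \<noteq> i}" for i
    by (rule clopen_baire_pairI) (auto intro!: exI[of _ 1])
  moreover have "closed ((\<lambda>p. (fst p, \<lambda>j. snd p (Suc j))) -` Q i)" for i
    by (intro closed_vimage[OF Q(1)] continuous_intros continuous_on_product_then_coordinatewise[where f=snd])
  ultimately have "closed R" unfolding R_def by (intro closed_INT ballI closed_Un) auto
  moreover have "(\<Union>i. B i) = {x. \<exists>y. (x, y) \<in> R}"
  proof (intro equalityI subsetI)
    fix x assume "x \<in> (\<Union>i. B i)"
    then obtain i y where "(x, y) \<in> Q i" using Q(2) by blast
    then have "(x, case_nat i y) \<in> R" by (auto simp: R_def)
    then show "x \<in> {x. \<exists>y. (x, y) \<in> R}" by blast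
  next
    fix x assume "x \<in> {x. \<exists>y. (x, y) \<in> R}"
    then obtain y where "(x, y) \<in> R" by blast
    then have "(x, \<lambda>j. y (Suc j)) \<in> Q (y 0)" by (auto simp: R_def)
    then have "x \<in> B (y 0)" unfolding Q(2) by blast
    then show "x \<in> (\<Union>i. B i)" by blast
  qed
  ultimately show ?thesis unfolding souslin_def by (intro exI[of _ R] conjI)
qed

text \<open>The pairing function packs one witness for every \<open>i\<close> into a single
  sequence.\<close>

lemma souslin_Inter:
  assumes "\<And>i::nat. souslin (B i)"
  shows "souslin (\<Inter>i. B i)"
proof -
  obtain Q where Q: "\<And>i. closed (Q i)" "\<And>i. B i = {x. \<exists>y :: nat \<Rightarrow> nat. (x, y) \<in> Q i}"
    using assms unfolding souslin_def by metis
  define R where "R = (\<Inter>i. (\<lambda>p. (fst p, \<lambda>j. snd p (prod_encode (i, j)))) -` Q i)"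
  have "closed R"
    unfolding R_def
    by (intro closed_INT ballI closed_vimage[OF Q(1)] continuous_intros
        continuous_on_product_then_coordinatewise[where f=snd])
  moreover have "(\<Inter>i. B i) = {x. \<exists>y. (x, y) \<in> R}"
  proof (intro equalityI subsetI)
    fix x assume "x \<in> (\<Inter>i. B i)"
    then have "\<forall>i. \<exists>y. (x, y) \<in> Q i" using Q(2) by blast
    then obtain y where y: "\<And>i. (x, y i) \<in> Q i" by metis
    have "(x, \<lambda>k. y (fst (prod_decode k)) (snd (prod_decode k))) \<in> R"
      using y by (simp add: R_def)
    then show "x \<in> {x. \<exists>y. (x, y) \<in> R}" by blast
  qed (use Q(2) in \<open>auto simp: R_def\<close>)
  ultimately show ?thesis unfolding souslin_def by (intro exI[of _ R] conjI)
qed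

lemma souslin_closed:
  assumes "closed B"
  shows "souslin B"
  unfolding souslin_def using assms
  by (intro exI[of _ "B \<times> UNIV"]) (auto intro: closed_Times)

text \<open>The second coordinate picks the radius of a basic neighbourhood inside the open set.\<close>

lemma souslin_open:
  assumes "open U"
  shows "souslin U"
proof -
  define Q where "Q = {(x, y :: nat \<Rightarrow> nat). \<forall>z. (\<forall>i<y 0. z i = x i) \<longrightarrow> z \<in> U}"
  have "closed Q"
  proof (rule clopen_baire_pairI)
    fix x y :: "nat \<Rightarrow> nat"
    show "\<exists>n. \<forall>x' y'. (\<forall>i<n. x' i = x i \<and> y' i = y i) \<longrightarrow> ((x', y') \<in> Q \<longleftrightarrow> (x, y) \<in> Q)"
      by (intro exI[of _ "Suc (y 0)"]) (simp add: Q_def)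
  qed
  moreover have "U = {x. \<exists>y. (x, y) \<in> Q}"
  proof (intro equalityI subsetI)
    fix x assume "x \<in> U"
    then obtain n where "\<forall>z. (\<forall>i<n. z i = x i) \<longrightarrow> z \<in> U"
      using assms unfolding open_baire_iff by blast
    then have "(x, \<lambda>_. n) \<in> Q" by (simp add: Q_def)
    then show "x \<in> {x. \<exists>y. (x, y) \<in> Q}" by blast
  qed (auto simp: Q_def)
  ultimately show ?thesis unfolding souslin_def by (intro exI[of _ Q] conjI)
qed

text \<open>Projections of closed sets are in general not closed under complement, so the induction
  carries each set together with its complement; De Morgan exchanges unions and
  intersections.\<close>

lemma souslin_borel:
  assumes "B \<in> sets borel"
  shows "souslin B"
proof -
  have "B \<in> sigma_sets UNIV {S. open S}"
    using assms by (simp add: borel_def)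
  then have "souslin B \<and> souslin (- B)"
  proof induction
    case (Basic a)
    then have "open a" "closed (- a)" by auto
    then show ?case using souslin_open souslin_closed by blast
  next
    case Empty
    have "closed {}" "closed (- {} :: (nat \<Rightarrow> nat) set)" by auto
    then show ?case using souslin_closed by blast
  next
    case (Compl a)
    then show ?case unfolding Compl_eq_Diff_UNIV[symmetric] double_complement by blast
  next
    case (Union a)
    then show ?case unfolding Compl_UN using souslin_Union[of a] souslin_Inter[of "\<lambda>i. - a i"] by blast
  qed
  then show ?thesis by blast
qed

text \<open>\<open>x\<close> has two roles: it is the indicator that is consulted and the point
  whose initial segment is looked up. This builds the diagonal in.\<close>

definition branch_step :: "nat \<Rightarrow> (nat \<Rightarrow> nat) \<Rightarrow> (nat \<Rightarrow> nat) \<Rightarrow> bool" where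
  "branch_step n x y \<longleftrightarrow> x (to_nat (map x [0..<n], map y [0..<n])) = 1"

definition zero_free :: "(nat \<Rightarrow> nat) \<Rightarrow> bool" where
  "zero_free y \<longleftrightarrow> (\<forall>n. 0 < y n)"

lemma closed_zero_free: "closed {y. zero_free y}"
proof -
  have "closed {y :: nat \<Rightarrow> nat. 0 < y n}" for n
    by (rule closed_baire_local[of "Suc n"]) auto
  then have "closed (\<Inter>n. {y :: nat \<Rightarrow> nat. 0 < y n})" by blast
  moreover have "{y. zero_free y} = (\<Inter>n. {y. 0 < y n})" by (auto simp: zero_free_def)
  ultimately show ?thesis by simp
qed

text \<open>A point \<open>x\<close> codes a tree of pairs of finite sequences; \<open>ill\<close> is the diagonal
  of the universal analytic set so obtained.  Restricting to positive branches frees the value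
  \<open>0\<close> to serve as an end marker of finite sequences.\<close>

definition ill :: "(nat \<Rightarrow> nat) set" where
  "ill = {x. \<exists>y. zero_free y \<and> (\<forall>n. branch_step n x y)}"

lemma branch_step_local:
  "\<exists>m. \<forall>x' y'. (\<forall>i<m. x' i = x i \<and> y' i = y i) \<longrightarrow> (branch_step n x' y' \<longleftrightarrow> branch_step n x y)"
proof -
  let ?c = "to_nat (map x [0..<n], map y [0..<n])"
  have "branch_step n x' y' \<longleftrightarrow> branch_step n x y"
    if *: "\<forall>i<max n (Suc ?c). x' i = x i \<and> y' i = y i" for x' y'
  proof -
    have "map x' [0..<n] = map x [0..<n]" "map y' [0..<n] = map y [0..<n]" "x' ?c = x ?c"
      using * by auto
    then show ?thesis by (simp only: branch_step_def)
  qed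
  then show ?thesis by blast
qed

lemma closed_branch_step: "closed {(x, y). branch_step n x y}"
  by (rule clopen_baire_pairI) (use branch_step_local in auto)

text \<open>The point \<open>c\<close> codes a closed set projecting onto \<open>B\<close>, so the
  diagonal test at \<open>c\<close> asks whether \<open>c\<close> lies in \<open>B\<close>. For
  \<open>B\<close> the complement of \<open>ill\<close> this is contradictory; as \<open>c\<close>
  is in \<open>cantor\<close>, the trace of \<open>ill\<close> there is refuted likewise.\<close>

lemma ill_diagonal:
  assumes "B \<in> sets borel"
  shows "\<exists>c\<in>cantor. c \<in> ill \<longleftrightarrow> c \<in> B"
proof -
  obtain Q where Q: "closed Q" "B = {x. \<exists>y :: nat \<Rightarrow> nat. (x, y) \<in> Q}"
    using souslin_borel[OF assms] unfolding souslin_def by blast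
  \<comment> \<open>The indicator of all pairs of initial segments of members of \<open>Q\<close>,
    second components raised by one so that witnesses become positive.\<close>
  define c :: "nat \<Rightarrow> nat" where
    "c k = (if \<exists>x y n. (x, y) \<in> Q \<and> k = to_nat (map x [0..<n], map (\<lambda>i. Suc (y i)) [0..<n])
            then 1 else 0)" for k
  have step: "branch_step n c y \<longleftrightarrow>
      (\<exists>x' y'. (x', y') \<in> Q \<and> (\<forall>i<n. x' i = c i \<and> Suc (y' i) = y i))" for n y
  proof -
    have "map c [0..<n] = map x' [0..<m] \<and> map y [0..<n] = map (\<lambda>i. Suc (y' i)) [0..<m]
      \<longleftrightarrow> m = n \<and> (\<forall>i<n. x' i = c i \<and> Suc (y' i) = y i)" for m x' y'
    proof (cases "m = n")
      case True
      then show ?thesis by (auto simp: map_eq_conv)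
    next
      case False
      then show ?thesis by (auto dest: arg_cong[of _ _ length])
    qed
    then show ?thesis
      by (auto simp: branch_step_def c_def)
  qed
  have "c \<in> ill \<longleftrightarrow> c \<in> B"
  proof
    assume "c \<in> ill"
    then obtain y where y: "zero_free y" "\<And>n. branch_step n c y" by (auto simp: ill_def)
    \<comment> \<open>Every initial segment of this pair extends to a member of \<open>Q\<close>, so
      the pair belongs to the closed set \<open>Q\<close>. Subtracting one undoes the shift.\<close>
    have "(c, \<lambda>i. y i - 1) \<in> Q"
    proof (rule ccontr)
      assume "(c, \<lambda>i. y i - 1) \<notin> Q"
      then have "(c, \<lambda>i. y i - 1) \<in> - Q" by simp
      moreover have "open (- Q)" using Q(1) by (simp add: closed_def)
      ultimately obtain n
        where n: "\<And>x' y'. (\<forall>i<n. x' i = c i \<and> y' i = y i - 1) \<Longrightarrow> (x', y') \<in> - Q"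
        unfolding open_baire_pair_iff by blast
      obtain x' y' where "(x', y') \<in> Q" "\<forall>i<n. x' i = c i \<and> Suc (y' i) = y i"
        using y(2) step by blast
      moreover from this have "\<forall>i<n. x' i = c i \<and> y' i = y i - 1" by (metis diff_Suc_1)
      ultimately show False using n[of x' y'] by simp
    qed
    then show "c \<in> B" using Q(2) by blast
  next
    assume "c \<in> B"
    then obtain y where "(c, y) \<in> Q" using Q(2) by blast
    then have "branch_step n c (\<lambda>i. Suc (y i))" for n
      unfolding step by blast
    then show "c \<in> ill" by (auto simp: ill_def zero_free_def intro!: exI[of _ "\<lambda>i. Suc (y i)"])
  qed
  moreover have "c \<in> cantor" by (simp add: c_def)
  ultimately show ?thesis by blast
qed

lemma closed_cantor: "closed cantor"
proof -
  have "closed {x :: nat \<Rightarrow> nat. x n \<in> {0, 1}}" for n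
    by (rule closed_baire_local[of "Suc n"]) auto
  then have "closed (\<Inter>n. {x :: nat \<Rightarrow> nat. x n \<in> {0, 1}})" by blast
  moreover have "cantor = (\<Inter>n. {x. x n \<in> {0, 1}})" by auto
  ultimately show ?thesis by simp
qed

lemma ill_not_borel: "ill \<notin> sets borel"
proof
  assume "ill \<in> sets borel"
  then have "- ill \<in> sets borel" by (rule borel_comp)
  from ill_diagonal[OF this] show False by auto
qed

lemma cantor_ill_not_borel: "cantor \<inter> ill \<notin> sets borel"
proof
  assume "cantor \<inter> ill \<in> sets borel"
  then have "- (cantor \<inter> ill) \<in> sets borel" by (rule borel_comp)
  from ill_diagonal[OF this] show False by auto
qed

lemma closed_ill_branches:
  "closed {(x, y). zero_free y \<and> (\<forall>n. branch_step n x y)}"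
proof -
  have "closed (UNIV \<times> {y. zero_free y} \<inter> (\<Inter>n. {(x, y). branch_step n x y}))"
    by (intro closed_INT ballI closed_Int closed_Times closed_UNIV closed_zero_free closed_branch_step)
  moreover have "{(x, y). zero_free y \<and> (\<forall>n. branch_step n x y)} =
      UNIV \<times> {y. zero_free y} \<inter> (\<Inter>n. {(x, y). branch_step n x y})"
    by auto
  ultimately show ?thesis by simp
qed

text \<open>A branch through the tree of \<open>x\<close> is interleaved with \<open>x\<close> into a single point.\<close>

lemma analytic_image_ill:
  assumes "closed X" "continuous_on UNIV f" "f ` (X \<inter> ill) \<subseteq> Y"
  shows "analytic_in (top_of_set Y) (f ` (X \<inter> ill))"
proof (rule analytic_in_imageI)
  let ?W = "{(x, y). zero_free y \<and> (\<forall>n. branch_step n x y)}"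
  let ?S = "(\<lambda>z. (\<lambda>n. z (2 * n), \<lambda>n. z (2 * n + 1))) -` (?W \<inter> X \<times> UNIV)"
  have even_part: "continuous_on T (\<lambda>z :: nat \<Rightarrow> nat. \<lambda>n. z (2 * n))" for T
    by (intro continuous_intros continuous_on_product_then_coordinatewise[where f="\<lambda>z. z"])
  have odd_part: "continuous_on T (\<lambda>z :: nat \<Rightarrow> nat. \<lambda>n. z (2 * n + 1))" for T
    by (intro continuous_intros continuous_on_product_then_coordinatewise[where f="\<lambda>z. z"])
  show "closed ?S"
    by (intro closed_vimage closed_Int closed_ill_branches closed_Times closed_UNIV assms
        continuous_on_Pair even_part odd_part)
  show "continuous_on ?S (\<lambda>z. f (\<lambda>n. z (2 * n)))"
    by (rule continuous_on_compose2[OF assms(2) even_part]) auto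
  show "(\<lambda>z. f (\<lambda>n. z (2 * n))) ` ?S = f ` (X \<inter> ill)"
  proof (intro equalityI subsetI)
    fix u assume "u \<in> f ` (X \<inter> ill)"
    then obtain x y where xy: "x \<in> X" "(x, y) \<in> ?W" "u = f x" by (auto simp: ill_def)
    define z where "z k = (if even k then x (k div 2) else y (k div 2))" for k
    have "(\<lambda>n. z (2 * n)) = x" "(\<lambda>n. z (2 * n + 1)) = y" by (auto simp: z_def)
    with xy have "z \<in> ?S" "u = f (\<lambda>n. z (2 * n))" by auto
    then show "u \<in> (\<lambda>z. f (\<lambda>n. z (2 * n))) ` ?S" by blast
  qed (auto simp: ill_def)
  show "f ` (X \<inter> ill) \<subseteq> Y" by (fact assms)
qed

section \<open>Embedding the Baire space into the real line\<close>

text \<open>A sequence is sent to the real whose ternary expansion is the indicator function of its graph;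
  as the digit \<open>2\<close> is avoided, the expansion is determined by the real.\<close>

definition graph_digit :: "(nat \<Rightarrow> nat) \<Rightarrow> nat \<Rightarrow> real" where
  "graph_digit y m = of_bool (y (fst (prod_decode m)) = snd (prod_decode m))"

definition baire_to_real :: "(nat \<Rightarrow> nat) \<Rightarrow> real" where
  "baire_to_real y = (\<Sum>m. graph_digit y m * (1/3) ^ Suc m)"

text \<open>Comparison with the geometric series, whose tail from \<open>M\<close> is
  \<open>(1/3)^M / 2\<close>. Digits of either sign are allowed because differences of expansions
  are to be estimated.\<close>

lemma ternary_tail:
  fixes d :: "nat \<Rightarrow> real"
  assumes d: "\<And>m. \<bar>d m\<bar> \<le> 1" and zero: "\<And>m. m < M \<Longrightarrow> d m = 0"
  shows "summable (\<lambda>m. d m * (1/3) ^ Suc m)"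
    and "\<bar>\<Sum>m. d m * (1/3) ^ Suc m\<bar> \<le> (1/3) ^ M / 2"
proof -
  let ?f = "\<lambda>m. d m * (1/3) ^ Suc m"
  have geo: "(\<lambda>m. (1/3) ^ Suc (m + M)) sums ((1/3) ^ M / 2 :: real)"
    using sums_mult[OF geometric_sums[of "1/3 :: real"], of "(1/3) ^ Suc M"]
    by (simp add: power_add mult_ac)
  have le: "\<bar>?f m\<bar> \<le> (1/3) ^ Suc m" for m
    using mult_right_mono[OF d[of m], of "(1/3) ^ Suc m"] by (simp add: abs_mult)
  have "summable (\<lambda>m. (1/3 :: real) ^ Suc m)"
    using summable_mult[OF summable_geometric[of "1/3 :: real"], of "1/3"] by simp
  then show sm: "summable ?f"
    by (rule summable_comparison_test'[where N=0]) (use le in simp)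
  have abs_sm: "summable (\<lambda>m. \<bar>?f (m + M)\<bar>)"
    by (rule summable_comparison_test'[OF sums_summable[OF geo], where N=0]) (use le in simp)
  have "(\<Sum>m. ?f m) = (\<Sum>m. ?f (m + M))"
    using suminf_split_initial_segment[OF sm, of M] zero by simp
  also have "\<bar>\<dots>\<bar> \<le> (\<Sum>m. \<bar>?f (m + M)\<bar>)"
    by (rule summable_rabs[OF abs_sm])
  also have "\<dots> \<le> (\<Sum>m. (1/3) ^ Suc (m + M))"
    by (rule suminf_le[OF le abs_sm sums_summable[OF geo]])
  also have "\<dots> = (1/3) ^ M / 2"
    using geo by (rule sums_unique[symmetric])
  finally show "\<bar>\<Sum>m. ?f m\<bar> \<le> (1/3) ^ M / 2" .
qed

lemma summable_graph_digit: "summable (\<lambda>m. graph_digit y m * (1/3) ^ Suc m)"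
  by (rule ternary_tail(1)[of _ 0]) (auto simp: graph_digit_def)

lemma baire_to_real_diff:
  "baire_to_real z - baire_to_real y =
    (\<Sum>m. (graph_digit z m - graph_digit y m) * (1/3) ^ Suc m)"
  unfolding baire_to_real_def left_diff_distrib
  by (rule suminf_diff[OF summable_graph_digit summable_graph_digit])

lemma graph_digit_diff_le: "\<bar>graph_digit z m - graph_digit y m\<bar> \<le> 1"
  by (auto simp: graph_digit_def)

lemma baire_to_real_bounds: "baire_to_real y \<in> {0..1}"
proof -
  have "\<bar>baire_to_real y\<bar> \<le> (1/3) ^ 0 / 2"
    unfolding baire_to_real_def by (rule ternary_tail(2)) (auto simp: graph_digit_def)
  moreover have "0 \<le> baire_to_real y"
    unfolding baire_to_real_def by (rule suminf_nonneg[OF summable_graph_digit]) (simp add: graph_digit_def)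
  ultimately show ?thesis by simp
qed

text \<open>Digit \<open>m\<close> concerns the entry with index \<open>fst (prod_decode m)\<close>,
  which is at most \<open>m\<close>; so the first \<open>n\<close> digits depend on the first
  \<open>n\<close> entries only.\<close>

lemma baire_to_real_close:
  assumes "\<forall>i<n. z i = y i"
  shows "\<bar>baire_to_real z - baire_to_real y\<bar> \<le> (1/3) ^ n / 2"
  unfolding baire_to_real_diff
proof (rule ternary_tail(2)[OF graph_digit_diff_le])
  fix m assume "m < n"
  moreover have "fst (prod_decode m) \<le> m"
    using le_prod_encode_1[of "fst (prod_decode m)" "snd (prod_decode m)"] by simp
  ultimately show "graph_digit z m - graph_digit y m = 0"
    using assms by (simp add: graph_digit_def)
qed

text \<open>The first differing digit \<open>k\<close> contributes \<open>(1/3)^(k+1)\<close> to the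
  difference, and all later digits together at most half of that.\<close>

lemma baire_to_real_far:
  assumes "graph_digit z m \<noteq> graph_digit y m"
  shows "\<exists>k\<le>m. (1/3) ^ Suc k / 2 \<le> \<bar>baire_to_real z - baire_to_real y\<bar>"
proof -
  define k where "k = (LEAST k. graph_digit z k \<noteq> graph_digit y k)"
  have k: "graph_digit z k \<noteq> graph_digit y k" "k \<le> m"
    unfolding k_def using assms by (rule LeastI, rule Least_le)
  have below: "graph_digit z j = graph_digit y j" if "j < k" for j
    using not_less_Least[OF that[unfolded k_def]] by simp
  define d where "d j = graph_digit z j - graph_digit y j" for j
  define e where "e = d(k := 0)"
  have dk: "\<bar>d k\<bar> = 1"
    using k(1) by (auto simp: d_def graph_digit_def split: if_splits)
  have e: "\<And>j. \<bar>e j\<bar> \<le> 1" "\<And>j. j < Suc k \<Longrightarrow> e j = 0"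
    using graph_digit_diff_le below by (auto simp: e_def d_def less_Suc_eq)
  have "(\<lambda>j. e j * (1/3) ^ Suc j + (if j = k then d k * (1/3) ^ Suc k else 0))
      sums ((\<Sum>j. e j * (1/3) ^ Suc j) + d k * (1/3) ^ Suc k)"
    by (intro sums_add summable_sums ternary_tail(1)[of e "Suc k"] e sums_single[of k "\<lambda>_. d k * (1/3) ^ Suc k"])
  moreover have "(\<lambda>j. e j * (1/3) ^ Suc j + (if j = k then d k * (1/3) ^ Suc k else 0))
      = (\<lambda>j. d j * (1/3) ^ Suc j)"
    by (auto simp: e_def)
  ultimately have "baire_to_real z - baire_to_real y
      = (\<Sum>j. e j * (1/3) ^ Suc j) + d k * (1/3) ^ Suc k"
    unfolding baire_to_real_diff d_def[symmetric] using sums_unique by metis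
  moreover have "\<bar>\<Sum>j. e j * (1/3) ^ Suc j\<bar> \<le> (1/3) ^ Suc k / 2"
    by (rule ternary_tail(2)) (use e in auto)
  moreover have "\<bar>d k * (1/3) ^ Suc k\<bar> = (1/3) ^ Suc k"
    using dk by (simp add: abs_mult)
  ultimately have "(1/3) ^ Suc k / 2 \<le> \<bar>baire_to_real z - baire_to_real y\<bar>"
    by linarith
  with k(2) show ?thesis by blast
qed

text \<open>The first \<open>n\<close> entries of \<open>y\<close> show in finitely many digits,
  those at the codes of \<open>(i, y i)\<close>; altering any of them moves the real by at least a
  fixed amount. Thus the inverse is continuous on the range.\<close>

lemma baire_to_real_separated:
  "\<exists>e>0. \<forall>z. \<bar>baire_to_real z - baire_to_real y\<bar> < e \<longrightarrow> (\<forall>i<n. z i = y i)"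
proof -
  obtain M where M: "\<And>i. i < n \<Longrightarrow> prod_encode (i, y i) < M"
    using finite_nat_set_iff_bounded[of "(\<lambda>i. prod_encode (i, y i)) ` {..<n}"] by auto
  have "z i = y i"
    if z: "\<bar>baire_to_real z - baire_to_real y\<bar> < (1/3) ^ M / 2" and "i < n" for z i
  proof (rule ccontr)
    assume "z i \<noteq> y i"
    then have "graph_digit z (prod_encode (i, y i)) \<noteq> graph_digit y (prod_encode (i, y i))"
      by (simp add: graph_digit_def)
    from baire_to_real_far[OF this] obtain k where
      k: "k \<le> prod_encode (i, y i)" "(1/3) ^ Suc k / 2 \<le> \<bar>baire_to_real z - baire_to_real y\<bar>" by blast
    have "(1/3 :: real) ^ M \<le> (1/3) ^ Suc k"
      using k(1) M[OF \<open>i < n\<close>] by (intro power_decreasing) auto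
    with k z show False by linarith
  qed
  then show ?thesis by (intro exI[of _ "(1/3) ^ M / 2"]) auto
qed

lemma baire_to_real_nbhd:
  assumes "0 < e"
  shows "\<exists>n. \<forall>z. (\<forall>i<n. z i = y i) \<longrightarrow> \<bar>baire_to_real z - baire_to_real y\<bar> < e"
proof -
  obtain n where "(1/3 :: real) ^ n < e"
    using real_arch_pow_inv[of e "1/3"] assms by auto
  moreover have "(0 :: real) \<le> (1/3) ^ n" by simp
  ultimately have "\<bar>baire_to_real z - baire_to_real y\<bar> < e" if "\<forall>i<n. z i = y i" for z
    using baire_to_real_close[OF that] by linarith
  then show ?thesis by blast
qed

lemma continuous_on_baire_to_real: "continuous_on UNIV baire_to_real"
proof -
  have "open (baire_to_real -` U)" if "open U" for U
    unfolding open_baire_iff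
  proof
    fix y assume "y \<in> baire_to_real -` U"
    then obtain e where e: "e > 0" "ball (baire_to_real y) e \<subseteq> U"
      using \<open>open U\<close> by (auto elim: openE)
    obtain n where "\<And>z. (\<forall>i<n. z i = y i) \<Longrightarrow> \<bar>baire_to_real z - baire_to_real y\<bar> < e"
      using baire_to_real_nbhd[OF e(1)] by blast
    then show "\<exists>n. \<forall>z. (\<forall>i<n. z i = y i) \<longrightarrow> z \<in> baire_to_real -` U"
      using e(2) by (intro exI[of _ n]) (auto simp: dist_real_def abs_minus_commute subset_iff)
  qed
  then show ?thesis by (simp add: continuous_on_open_vimage)
qed

text \<open>Around each \<open>baire_to_real y\<close> choose a ball meeting the range only in images of sequences
  with the same \<open>n\<close>th value; membership in the union of these balls over all \<open>y\<close> with
  \<open>y n = k\<close> decides the \<open>n\<close>th value.\<close>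

lemma baire_decoding:
  obtains dec :: "real \<Rightarrow> nat \<Rightarrow> nat"
  where "dec \<in> borel_measurable borel" "\<And>y. dec (baire_to_real y) = y"
proof -
  obtain r where r: "\<And>y n. 0 < r y n"
    "\<And>y n z. \<bar>baire_to_real z - baire_to_real y\<bar> < r y n \<Longrightarrow> z n = y n"
    using baire_to_real_separated[of _ "Suc _"] by (metis lessI)
  define V where "V n k = (\<Union>y\<in>{y. y n = k}. ball (baire_to_real y) (r y n))" for n k
  \<comment> \<open>Off the range of \<open>baire_to_real\<close> no particular value is intended;
    measurability holds on the whole line because each \<open>V n k\<close> is open.\<close>
  define dec where "dec u n = (LEAST k. u \<in> V n k)" for u n
  have V: "baire_to_real z \<in> V n k \<longleftrightarrow> z n = k" for z n k
  proof
    assume "baire_to_real z \<in> V n k"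
    then obtain y where "y n = k" "\<bar>baire_to_real z - baire_to_real y\<bar> < r y n"
      by (auto simp: V_def dist_real_def abs_minus_commute)
    then show "z n = k" using r(2) by blast
  qed (use r(1) in \<open>auto simp: V_def\<close>)
  have "dec (baire_to_real y) = y" for y
    by (auto simp: dec_def V fun_eq_iff intro: Least_equality)
  moreover have "dec \<in> borel_measurable borel"
  proof (rule measurable_coordinatewise_then_product)
    fix n
    have "open (V n k)" for k by (auto simp: V_def)
    then have "Measurable.pred borel (\<lambda>u. u \<in> V n k)" for k
      by (auto simp: pred_def intro: borel_open)
    then have "(\<lambda>u. dec u n) \<in> measurable borel (count_space UNIV)"
      unfolding dec_def by (rule measurable_Least)
    then show "(\<lambda>u. dec u n) \<in> borel_measurable borel"
      by (rule measurable_compose) simp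
  qed
  ultimately show thesis using that by blast
qed

section \<open>Marked sequences\<close>

definition first_zero :: "nat \<Rightarrow> (nat \<Rightarrow> nat) \<Rightarrow> bool" where
  "first_zero n y \<longleftrightarrow> y n = 0 \<and> (\<forall>j<n. 0 < y j)"

text \<open>The entry following the first zero carries the mark \<open>b\<close>.  As the mark separates the
  values of the multifunctions below at arbitrarily close arguments, only positive sequences can
  witness continuity.\<close>

definition marked :: "nat \<Rightarrow> (nat \<Rightarrow> nat) set" where
  "marked b = {y. \<forall>n. first_zero n y \<longrightarrow> y (Suc n) = b}"

text \<open>The first \<open>n\<close> entries of \<open>y\<close> as a finite sequence, presented
  as a point of the Baire space: end marker, then the mark, repeated to fill the tail.\<close>

definition cut :: "nat \<Rightarrow> nat \<Rightarrow> (nat \<Rightarrow> nat) \<Rightarrow> nat \<Rightarrow> nat" where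
  "cut n b y = (\<lambda>k. if k < n then y k else if k = n then 0 else b)"

lemma first_zero_exists: "\<not> zero_free y \<Longrightarrow> \<exists>n. first_zero n y"
  unfolding zero_free_def first_zero_def using exists_least_iff[of "\<lambda>n. y n = 0"] by auto

text \<open>Without a zero the marking condition is vacuous, so a branch may occur at arguments of
  either bit.\<close>

lemma zero_free_marked:
  assumes "zero_free y"
  shows "y \<in> marked b"
proof -
  have "\<not> first_zero n y" for n
    using assms[unfolded zero_free_def, rule_format, of n] by (simp add: first_zero_def)
  then show ?thesis by (simp add: marked_def)
qed

lemma first_zero_cut: "zero_free y \<Longrightarrow> first_zero m (cut n b y) \<longleftrightarrow> m = n"
  unfolding first_zero_def cut_def zero_free_def
  by (metis less_irrefl linorder_neqE_nat)

lemma cut_marked: "zero_free y \<Longrightarrow> cut n b y \<in> marked b"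
  by (simp add: marked_def first_zero_cut) (simp add: cut_def)

text \<open>The end marker and the mark lie in a finite initial segment; a sequence sharing it has
  the same first zero and hence the same mark.\<close>

lemma marked_separated:
  assumes "y \<in> marked b" "\<not> zero_free y" "b \<noteq> b'"
  shows "\<exists>n. \<forall>z\<in>marked b'. \<not> (\<forall>i<n. z i = y i)"
proof -
  obtain n where n: "first_zero n y" using first_zero_exists assms(2) by blast
  have "z \<notin> marked b'" if "\<forall>i<Suc (Suc n). z i = y i" for z
  proof
    assume "z \<in> marked b'"
    moreover have "first_zero n z" using n that by (auto simp: first_zero_def)
    ultimately have "z (Suc n) = b'" by (simp add: marked_def)
    moreover have "y (Suc n) = b" using assms(1) n by (simp add: marked_def)
    ultimately show False using that assms(3) by simp
  qed
  then show ?thesis by blast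
qed

lemma closed_marked: "closed (marked b)"
proof -
  have "closed {y. first_zero n y \<longrightarrow> y (Suc n) = b}" for n
    by (rule closed_baire_local[of "Suc (Suc n)"]) (auto simp: first_zero_def)
  then have "closed (\<Inter>n. {y. first_zero n y \<longrightarrow> y (Suc n) = b})" by blast
  moreover have "marked b = (\<Inter>n. {y. first_zero n y \<longrightarrow> y (Suc n) = b})"
    by (auto simp: marked_def)
  ultimately show ?thesis by simp
qed

text \<open>The analogue of rationality: in the Cantor space the eventually zero points are dense,
  as are the others, and they form a Borel set.\<close>

definition tail_bit :: "(nat \<Rightarrow> nat) \<Rightarrow> nat" where
  "tail_bit x = of_bool (\<exists>m. \<forall>k\<ge>m. x k = 0)"

lemma tail_bit_dense:
  assumes "x \<in> cantor" "b \<le> 1"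
  shows "\<exists>z\<in>cantor. (\<forall>i<n. z i = x i) \<and> tail_bit z = b"
proof -
  \<comment> \<open>A tail of zeros yields bit 1 and a tail of ones yields bit 0, whence
    \<open>1 - b\<close>.\<close>
  let ?z = "\<lambda>k. if k < n then x k else 1 - b"
  have "?z \<in> cantor" using assms by auto
  moreover have "tail_bit ?z = b"
  proof (cases "b = 1")
    case True
    then show ?thesis by (auto simp: tail_bit_def intro!: exI[of _ n])
  next
    case False
    then have "b = 0" using assms(2) by simp
    have "\<exists>k\<ge>m. ?z k \<noteq> 0" for m
      using \<open>b = 0\<close> by (intro exI[of _ "max m n"]) auto
    then show ?thesis unfolding tail_bit_def using \<open>b = 0\<close> by auto
  qed
  ultimately show ?thesis by (intro bexI[of _ ?z]) auto
qed

lemma borel_tail_bit: "{x. tail_bit x = 1} \<in> sets borel"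
proof -
  have "closed {x :: nat \<Rightarrow> nat. m \<le> k \<longrightarrow> x k = 0}" for m k
    by (rule closed_baire_local[of "Suc k"]) auto
  then have "closed (\<Inter>k. {x :: nat \<Rightarrow> nat. m \<le> k \<longrightarrow> x k = 0})" for m by blast
  then have "(\<Union>m. \<Inter>k. {x :: nat \<Rightarrow> nat. m \<le> k \<longrightarrow> x k = 0}) \<in> sets borel"
    by (intro sets.countable_UN) (auto intro: borel_closed)
  moreover have "{x. tail_bit x = 1} = (\<Union>m. \<Inter>k. {x. m \<le> k \<longrightarrow> x k = 0})"
    by (auto simp: tail_bit_def)
  ultimately show ?thesis by simp
qed

lemma borel_marked_by:
  fixes E :: "'a::topological_space set"
  assumes "E \<in> sets borel"
  shows "{(x, y). y \<in> marked (of_bool (x \<in> E))} \<in> sets borel"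
proof -
  have "{(x, y). y \<in> marked (of_bool (x \<in> E))} = E \<times> marked 1 \<union> (- E) \<times> marked 0"
    (is "?L = ?R")
  proof (rule set_eqI)
    fix p :: "'a \<times> (nat \<Rightarrow> nat)"
    obtain x y where p: "p = (x, y)" by (cases p)
    show "p \<in> ?L \<longleftrightarrow> p \<in> ?R" unfolding p by (cases "x \<in> E") simp_all
  qed
  also have "\<dots> \<in> sets borel"
    by (intro sets.Un borel_Times borel_closed borel_comp assms closed_marked)
  finally show ?thesis .
qed

text \<open>The guard includes index \<open>n\<close>, so a sequence with first zero at
  \<open>n\<close> has to satisfy just the steps below \<open>n\<close>, and one starting with
  \<open>0\<close> none at all. For positive sequences the guard disappears.\<close>

definition positive_steps :: "((nat \<Rightarrow> nat) \<times> (nat \<Rightarrow> nat)) set" where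
  "positive_steps = {(x, y). \<forall>n. (\<forall>j\<le>n. 0 < y j) \<longrightarrow> branch_step n x y}"

lemma closed_positive_steps: "closed positive_steps"
proof -
  have "closed {(x, y). (\<forall>j\<le>n. 0 < y j) \<longrightarrow> branch_step n x y}" for n
  proof (rule clopen_baire_pairI)
    fix x y :: "nat \<Rightarrow> nat"
    obtain m where m: "\<And>x' y'. (\<forall>i<m. x' i = x i \<and> y' i = y i) \<Longrightarrow>
        branch_step n x' y' \<longleftrightarrow> branch_step n x y"
      using branch_step_local by blast
    have "((\<forall>j\<le>n. 0 < y' j) \<longrightarrow> branch_step n x' y') \<longleftrightarrow> ((\<forall>j\<le>n. 0 < y j) \<longrightarrow> branch_step n x y)"
      if "\<forall>i<max m (Suc n). x' i = x i \<and> y' i = y i" for x' y'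
      using that m[of x' y'] by simp
    then show "\<exists>m. \<forall>x' y'. (\<forall>i<m. x' i = x i \<and> y' i = y i) \<longrightarrow>
        ((x', y') \<in> {(x, y). (\<forall>j\<le>n. 0 < y j) \<longrightarrow> branch_step n x y} \<longleftrightarrow>
         (x, y) \<in> {(x, y). (\<forall>j\<le>n. 0 < y j) \<longrightarrow> branch_step n x y})"
      unfolding mem_Collect_eq prod.case by blast
  qed
  then have "closed (\<Inter>n. {(x, y). (\<forall>j\<le>n. 0 < y j) \<longrightarrow> branch_step n x y})" by blast
  moreover have "positive_steps = (\<Inter>n. {(x, y). (\<forall>j\<le>n. 0 < y j) \<longrightarrow> branch_step n x y})"
    by (auto simp: positive_steps_def)
  ultimately show ?thesis by simp
qed

lemma positive_steps_iff:
  "zero_free y \<Longrightarrow> (x, y) \<in> positive_steps \<longleftrightarrow> (\<forall>n. branch_step n x y)"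
  by (simp add: positive_steps_def zero_free_def)

lemma branch_step_cong:
  assumes "\<forall>i<n. z i = y i"
  shows "branch_step n x z \<longleftrightarrow> branch_step n x y"
proof -
  have "map z [0..<n] = map y [0..<n]" using assms by auto
  then show ?thesis by (simp only: branch_step_def)
qed

text \<open>A cut sequence has to satisfy finitely many steps, all inherited from \<open>y\<close>,
  and each survives small changes of \<open>x\<close>.\<close>

lemma cut_positive_steps:
  assumes "zero_free y" "(x, y) \<in> positive_steps"
  shows "\<exists>m. \<forall>z. (\<forall>i<m. z i = x i) \<longrightarrow> (z, cut n b y) \<in> positive_steps"
proof -
  have "\<exists>m. \<forall>z. (\<forall>i<m. z i = x i) \<longrightarrow> branch_step k z y" for k
  proof -
    have "branch_step k x y" using assms by (simp add: positive_steps_iff)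
    then show ?thesis using branch_step_local[where n=k and x=x and y=y] by blast
  qed
  then obtain m where m: "\<And>k z. (\<forall>i<m k. z i = x i) \<Longrightarrow> branch_step k z y" by metis
  have "(z, cut n b y) \<in> positive_steps" if z: "\<forall>i<Max (m ` {..n}). z i = x i" for z
  proof -
    have "branch_step k z (cut n b y)" if "\<forall>j\<le>k. 0 < cut n b y j" for k
    proof -
      \<comment> \<open>The cut is \<open>0\<close> at \<open>n\<close>, so positivity up to
        \<open>k\<close> forces \<open>k < n\<close>.\<close>
      have "k < n" using that[rule_format, of n] by (auto simp: cut_def intro: ccontr)
      then have "m k \<le> Max (m ` {..n})" by simp
      then have "branch_step k z y" using m z by auto
      moreover have "\<forall>i<k. cut n b y i = y i" using \<open>k < n\<close> by (simp add: cut_def)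
      ultimately show ?thesis using branch_step_cong by blast
    qed
    then show ?thesis by (simp add: positive_steps_def)
  qed
  then show ?thesis by blast
qed

section \<open>The multifunction on the Cantor space\<close>

definition cantor_multi :: "(nat \<Rightarrow> nat) \<Rightarrow> (nat \<Rightarrow> nat) set" where
  "cantor_multi x = {y \<in> marked (tail_bit x). (x, y) \<in> positive_steps}"

lemma cantor_multi_nonempty: "cantor_multi x \<noteq> {}"
proof -
  have "cut 0 (tail_bit x) (\<lambda>_. 1) \<in> marked (tail_bit x)"
    by (rule cut_marked) (simp add: zero_free_def)
  moreover have "(x, cut 0 (tail_bit x) (\<lambda>_. 1)) \<in> positive_steps"
    by (auto simp: positive_steps_def cut_def)
  ultimately show ?thesis unfolding cantor_multi_def by blast
qed

lemma closed_cantor_multi: "closed (cantor_multi x)"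
proof -
  have "cantor_multi x = marked (tail_bit x) \<inter> Pair x -` positive_steps"
    by (auto simp: cantor_multi_def)
  then show ?thesis
    by (auto intro!: closed_Int closed_marked closed_vimage[OF closed_positive_steps] continuous_intros)
qed

lemma borel_graph_cantor_multi: "graph_of cantor_space cantor_multi \<in> sets borel"
proof -
  have "tail_bit x = of_bool (x \<in> {x. tail_bit x = 1})" for x
    by (simp add: tail_bit_def)
  then have "graph_of cantor_space cantor_multi = cantor \<times> UNIV \<inter> positive_steps \<inter>
      {(x, y). y \<in> marked (of_bool (x \<in> {x. tail_bit x = 1}))}"
    by (auto simp: graph_of_def cantor_multi_def mspace_cantor_space)
  also have "\<dots> \<in> sets borel"
    by (intro sets.Int borel_marked_by[OF borel_tail_bit] borel_closed closed_Times closed_cantor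
        closed_positive_steps closed_UNIV)
  finally show ?thesis .
qed

lemma ill_multi_continuous_at:
  assumes "x \<in> ill"
  shows "multi_continuous_at cantor_space baire_space cantor_multi x"
  unfolding multi_continuous_at_def mspace_cantor_space mdist_cantor_space mdist_baire_space
proof -
  obtain y where y: "zero_free y" "(x, y) \<in> positive_steps"
    using assms by (auto simp: ill_def positive_steps_iff)
  show "\<exists>y\<in>cantor_multi x. \<forall>\<epsilon>>0. \<exists>\<delta>>0. \<forall>x'\<in>cantor. baire_dist x x' < \<delta> \<longrightarrow>
      (\<exists>y'\<in>cantor_multi x'. baire_dist y y' < \<epsilon>)"
  proof (intro bexI[of _ y] allI impI)
    show "y \<in> cantor_multi x" using y by (simp add: cantor_multi_def zero_free_marked)
    fix \<epsilon> :: real assume "\<epsilon> > 0"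
    then obtain N where N: "1 / real (Suc N) < \<epsilon>"
      using reals_Archimedean[of \<epsilon>] by (auto simp: inverse_eq_divide)
    \<comment> \<open>\<open>m\<close> has to serve both marks, because closeness of
      \<open>x'\<close> to \<open>x\<close> does not determine the bit of \<open>x'\<close>.\<close>
    have "\<exists>m. \<forall>b\<le>1. \<forall>z. (\<forall>i<m. z i = x i) \<longrightarrow> (z, cut (Suc N) b y) \<in> positive_steps"
    proof -
      obtain m0 m1 where
        "\<And>z. (\<forall>i<m0. z i = x i) \<Longrightarrow> (z, cut (Suc N) 0 y) \<in> positive_steps"
        "\<And>z. (\<forall>i<m1. z i = x i) \<Longrightarrow> (z, cut (Suc N) 1 y) \<in> positive_steps"
        using cut_positive_steps[OF y] by meson
      then show ?thesis
        by (intro exI[of _ "max m0 m1"]) (auto simp: le_Suc_eq)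
    qed
    then obtain m where m: "\<And>b z. b \<le> 1 \<Longrightarrow> (\<forall>i<m. z i = x i) \<Longrightarrow> (z, cut (Suc N) b y) \<in> positive_steps"
      by blast
    show "\<exists>\<delta>>0. \<forall>x'\<in>cantor. baire_dist x x' < \<delta> \<longrightarrow> (\<exists>y'\<in>cantor_multi x'. baire_dist y y' < \<epsilon>)"
    proof (intro exI[of _ "1 / real (Suc m)"] conjI ballI impI)
      fix x' assume "baire_dist x x' < 1 / real (Suc m)"
      then have "\<forall>i<m. x' i = x i" unfolding baire_dist_less_iff by simp
      then have "cut (Suc N) (tail_bit x') y \<in> cantor_multi x'"
        using m cut_marked[OF y(1)] by (simp add: cantor_multi_def tail_bit_def)
      \<comment> \<open>Cutting at \<open>Suc N\<close> preserves the entries up to and including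
        \<open>N\<close>.\<close>
      moreover have "baire_dist y (cut (Suc N) (tail_bit x') y) < 1 / real (Suc N)"
        unfolding baire_dist_less_iff by (simp add: cut_def)
      ultimately show "\<exists>y'\<in>cantor_multi x'. baire_dist y y' < \<epsilon>"
        using N by (meson less_trans)
    qed simp
  qed
qed

lemma multi_continuous_at_imp_ill:
  assumes "x \<in> cantor" "multi_continuous_at cantor_space baire_space cantor_multi x"
  shows "x \<in> ill"
proof -
  obtain y where y: "y \<in> cantor_multi x" and
    cont: "\<And>\<epsilon>. \<epsilon> > 0 \<Longrightarrow> \<exists>\<delta>>0. \<forall>x'\<in>cantor. baire_dist x x' < \<delta> \<longrightarrow>
      (\<exists>y'\<in>cantor_multi x'. baire_dist y y' < \<epsilon>)"
    using assms(2)
    unfolding multi_continuous_at_def mspace_cantor_space mdist_cantor_space mdist_baire_space by blast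
  have ym: "y \<in> marked (tail_bit x)" using y by (simp add: cantor_multi_def)
  have "zero_free y"
  proof (rule ccontr)
    assume "\<not> zero_free y"
    \<comment> \<open>\<open>1 - tail_bit x\<close> is the opposite mark, which arguments
      arbitrarily near \<open>x\<close> carry; sequences so marked keep away from
      \<open>y\<close>.\<close>
    have "tail_bit x \<noteq> 1 - tail_bit x" by (simp add: tail_bit_def)
    from marked_separated[OF ym \<open>\<not> zero_free y\<close> this] obtain n where
      n: "\<And>z. z \<in> marked (1 - tail_bit x) \<Longrightarrow> \<not> (\<forall>i<n. z i = y i)" by blast
    obtain \<delta> where \<delta>: "\<delta> > 0" "\<And>x'. x' \<in> cantor \<Longrightarrow> baire_dist x x' < \<delta> \<Longrightarrow>
        \<exists>y'\<in>cantor_multi x'. baire_dist y y' < 1 / real (Suc n)"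
      using cont[of "1 / real (Suc n)"] by auto
    obtain m where m: "1 / real (Suc m) < \<delta>"
      using reals_Archimedean[OF \<delta>(1)] by (auto simp: inverse_eq_divide)
    obtain x' where x': "x' \<in> cantor" "\<forall>i<Suc m. x' i = x i" "tail_bit x' = 1 - tail_bit x"
      using tail_bit_dense[OF assms(1), of "1 - tail_bit x" "Suc m"] by auto
    have "baire_dist x x' < 1 / real (Suc m)"
      unfolding baire_dist_less_iff using x'(2) by simp
    then obtain z where z: "z \<in> cantor_multi x'" "baire_dist y z < 1 / real (Suc n)"
      using \<delta>(2)[OF x'(1)] m by fastforce
    have "\<forall>i<n. z i = y i" using z(2) unfolding baire_dist_less_iff by simp
    moreover have "z \<in> marked (1 - tail_bit x)" using z(1) x'(3) by (simp add: cantor_multi_def)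
    ultimately show False using n by blast
  qed
  then show ?thesis
    using y by (auto simp: ill_def cantor_multi_def positive_steps_iff)
qed

lemma continuity_points_cantor_multi:
  "continuity_points cantor_space baire_space cantor_multi = cantor \<inter> ill"
  unfolding continuity_points_def mspace_cantor_space
  using ill_multi_continuous_at multi_continuous_at_imp_ill by blast

section \<open>The multifunction on the unit interval\<close>

definition rational_bit :: "real \<Rightarrow> nat" where
  "rational_bit u = of_bool (u \<in> \<rat>)"

lemma rational_bit_dense:
  assumes "u \<in> {0..1}" "0 < \<delta>" "b \<le> 1"
  shows "\<exists>v\<in>{0..1}. dist u v < \<delta> \<and> rational_bit v = b"
proof -
  \<comment> \<open>Clipping at 0 and 1 leaves a nondegenerate interval even when \<open>u\<close>
    is an endpoint.\<close>
  define l where "l = max 0 (u - \<delta>)"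
  define h where "h = min 1 (u + \<delta>)"
  have lh: "l < h" using assms by (auto simp: l_def h_def)
  have "\<exists>v\<in>{l<..<h}. rational_bit v = b"
  proof (cases "b = 1")
    case True
    then show ?thesis using Rats_dense_in_real[OF lh] by (auto simp: rational_bit_def)
  next
    case False
    have "\<not> {l<..<h} \<subseteq> \<rat>"
      using uncountable_open_interval[of l h] lh countable_rat countable_subset by blast
    then show ?thesis using False assms(3) by (auto simp: rational_bit_def)
  qed
  then show ?thesis by (force simp: l_def h_def dist_real_def)
qed

text \<open>\<open>dec\<close> is to be a left inverse of \<open>baire_to_real\<close>; the equation for \<open>dec u\<close> says that \<open>u\<close> lies
  in the range of \<open>baire_to_real\<close>.\<close>

definition interval_multi :: "(real \<Rightarrow> nat \<Rightarrow> nat) \<Rightarrow> real \<Rightarrow> real set" where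
  "interval_multi dec u = baire_to_real ` {y \<in> marked (rational_bit u).
     zero_free y \<longrightarrow> baire_to_real (dec u) = u \<and> (dec u, y) \<in> positive_steps}"

lemma interval_multi_nonempty: "interval_multi dec u \<noteq> {}"
proof -
  let ?y = "cut 0 (rational_bit u) (\<lambda>_. 1)"
  have "?y \<in> marked (rational_bit u)"
    by (rule cut_marked) (simp add: zero_free_def)
  moreover have "\<not> zero_free ?y" by (auto simp: zero_free_def cut_def)
  ultimately show ?thesis unfolding interval_multi_def by blast
qed

text \<open>Reading the second coordinate through \<open>dec\<close>, and requiring it to lie in the
  range of \<open>baire_to_real\<close>, replaces the image in the definition by Borel
  preimages.\<close>

lemma borel_graph_interval_multi:
  assumes dec[measurable]: "dec \<in> borel_measurable borel" and dec_inv: "\<And>y. dec (baire_to_real y) = y"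
  shows "graph_of unit_interval (interval_multi dec) \<in> sets borel"
proof -
  have [measurable]: "baire_to_real \<in> borel_measurable borel"
    using continuous_on_baire_to_real by (rule borel_measurable_continuous_onI)
  have fix_borel: "{u. baire_to_real (dec u) = u} \<in> sets borel" by measurable
  have m1: "(\<lambda>p. (fst p, dec (snd p))) \<in> measurable (borel :: (real \<times> real) measure) borel"
    unfolding borel_prod[symmetric] by measurable
  have m2: "(\<lambda>p. (dec (fst p), dec (snd p))) \<in> measurable (borel :: (real \<times> real) measure) borel"
    unfolding borel_prod[symmetric] by measurable
  define A where "A = (\<lambda>p. (fst p, dec (snd p))) -` {(u :: real, y). y \<in> marked (of_bool (u \<in> \<rat>))}"
  define B where "B = (\<lambda>p. (dec (fst p), dec (snd p))) -` (UNIV \<times> {y. zero_free y})"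
  define C where "C = (\<lambda>p. (dec (fst p), dec (snd p))) -` positive_steps"
  have rats: "(\<rat> :: real set) \<in> sets borel"
    by (rule sets.countable[OF _ countable_rat]) simp
  have A: "A \<in> sets borel"
    unfolding A_def using measurable_sets[OF m1 borel_marked_by[OF rats]]
    by (simp only: space_borel Int_UNIV_right)
  have B: "B \<in> sets borel"
    unfolding B_def using measurable_sets[OF m2 borel_closed[OF closed_Times[OF closed_UNIV closed_zero_free]]]
    by simp
  have C: "C \<in> sets borel"
    unfolding C_def using measurable_sets[OF m2 borel_closed[OF closed_positive_steps]] by simp
  let ?R = "{u. baire_to_real (dec u) = u}"
  \<comment> \<open>\<open>UNIV \<times> ?R\<close> puts the second coordinate into the range; the
    union with \<open>- B\<close> is the implication guarded by positivity.\<close>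
  have "graph_of unit_interval (interval_multi dec) =
      {0..1} \<times> {0..1} \<inter> UNIV \<times> ?R \<inter> A \<inter> (- B \<union> ?R \<times> UNIV \<inter> C)" (is "?L = ?G")
  proof (intro equalityI subsetI)
    fix p assume "p \<in> ?L"
    then show "p \<in> ?G"
      using baire_to_real_bounds
      by (auto simp: graph_of_def mspace_unit_interval interval_multi_def A_def B_def C_def
          rational_bit_def dec_inv)
  next
    fix p assume p: "p \<in> ?G"
    obtain u v where uv: "p = (u, v)" by (cases p)
    have "v \<in> interval_multi dec u"
      unfolding interval_multi_def
    proof (rule image_eqI[of _ _ "dec v"])
      show "v = baire_to_real (dec v)" using p uv by simp
    qed (use p uv in \<open>auto simp: A_def B_def C_def rational_bit_def\<close>)
    then show "p \<in> ?L" using p uv by (simp add: graph_of_def mspace_unit_interval)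
  qed
  also have "\<dots> \<in> sets borel"
    by (intro sets.Int sets.Un borel_Times borel_comp A B C fix_borel) auto
  finally show ?thesis .
qed

lemma continuity_points_interval_multi:
  assumes dec: "\<And>y. dec (baire_to_real y) = y"
  shows "continuity_points unit_interval unit_interval (interval_multi dec) = baire_to_real ` ill"
    (is "?L = ?R")
proof (intro equalityI subsetI)
  fix u assume "u \<in> ?R"
  then obtain x y where u: "u = baire_to_real x" and y: "zero_free y" "(x, y) \<in> positive_steps"
    by (auto simp: ill_def positive_steps_iff)
  have "baire_to_real y \<in> interval_multi dec u"
    using y by (auto simp: interval_multi_def zero_free_marked u dec)
  moreover have "\<exists>\<delta>>0. \<forall>u'\<in>{0..1}. dist u u' < \<delta> \<longrightarrow>
      (\<exists>v\<in>interval_multi dec u'. dist (baire_to_real y) v < \<epsilon>)" if \<epsilon>: "\<epsilon> > 0" for \<epsilon>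
  \<comment> \<open>Any positive radius works: the cut of \<open>y\<close>, suitably marked, is a
    value at every argument.\<close>
  proof (intro exI[of _ 1] conjI ballI impI)
    fix u' :: real
    obtain n where n: "\<And>z. (\<forall>i<n. z i = y i) \<Longrightarrow> \<bar>baire_to_real z - baire_to_real y\<bar> < \<epsilon>"
      using baire_to_real_nbhd[OF \<epsilon>] by blast
    let ?z = "cut n (rational_bit u') y"
    have "\<not> zero_free ?z" by (auto simp: zero_free_def cut_def)
    then have "baire_to_real ?z \<in> interval_multi dec u'"
      using cut_marked[OF y(1)] by (auto simp: interval_multi_def)
    moreover have "dist (baire_to_real y) (baire_to_real ?z) < \<epsilon>"
      using n[of ?z] by (simp add: cut_def dist_real_def abs_minus_commute)
    ultimately show "\<exists>v\<in>interval_multi dec u'. dist (baire_to_real y) v < \<epsilon>" by blast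
  qed simp
  moreover have "u \<in> {0..1}" using u baire_to_real_bounds by simp
  ultimately show "u \<in> ?L"
    unfolding continuity_points_def multi_continuous_at_def mspace_unit_interval mdist_unit_interval
    by blast
next
  fix u assume "u \<in> ?L"
  then obtain v where u: "u \<in> {0..1}" and v: "v \<in> interval_multi dec u" and
    cont: "\<And>\<epsilon>. \<epsilon> > 0 \<Longrightarrow> \<exists>\<delta>>0. \<forall>u'\<in>{0..1}. dist u u' < \<delta> \<longrightarrow>
      (\<exists>v'\<in>interval_multi dec u'. dist v v' < \<epsilon>)"
    unfolding continuity_points_def multi_continuous_at_def mspace_unit_interval mdist_unit_interval
    by blast
  from v obtain y where y: "v = baire_to_real y" "y \<in> marked (rational_bit u)"
    "zero_free y \<Longrightarrow> baire_to_real (dec u) = u \<and> (dec u, y) \<in> positive_steps"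
    by (auto simp: interval_multi_def)
  have "zero_free y"
  proof (rule ccontr)
    assume "\<not> zero_free y"
    have "rational_bit u \<noteq> 1 - rational_bit u" by (simp add: rational_bit_def)
    from marked_separated[OF y(2) \<open>\<not> zero_free y\<close> this] obtain n where
      n: "\<And>z. z \<in> marked (1 - rational_bit u) \<Longrightarrow> \<not> (\<forall>i<n. z i = y i)" by blast
    obtain \<epsilon> where \<epsilon>: "\<epsilon> > 0"
      "\<And>z. \<bar>baire_to_real z - baire_to_real y\<bar> < \<epsilon> \<Longrightarrow> \<forall>i<n. z i = y i"
      using baire_to_real_separated[of y n] by blast
    obtain \<delta> where \<delta>: "\<delta> > 0" "\<And>u'. u' \<in> {0..1} \<Longrightarrow> dist u u' < \<delta> \<Longrightarrow>
        \<exists>v'\<in>interval_multi dec u'. dist v v' < \<epsilon>"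
      using cont[OF \<epsilon>(1)] by blast
    obtain u' where u': "u' \<in> {0..1}" "dist u u' < \<delta>" "rational_bit u' = 1 - rational_bit u"
      using rational_bit_dense[OF u \<delta>(1), of "1 - rational_bit u"] by auto
    then obtain v' where "v' \<in> interval_multi dec u'" "dist v v' < \<epsilon>" using \<delta>(2) by blast
    then obtain z where "z \<in> marked (1 - rational_bit u)" "\<bar>baire_to_real z - baire_to_real y\<bar> < \<epsilon>"
      using y(1) u'(3) by (auto simp: interval_multi_def dist_real_def abs_minus_commute)
    then show False using n \<epsilon>(2) by blast
  qed
  \<comment> \<open>Positivity releases the guard in \<open>interval_multi\<close>: \<open>u\<close>
    lies in the range and its decoded point has the branch \<open>y\<close>.\<close>
  then have "dec u \<in> ill" "u = baire_to_real (dec u)"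
    using y(3) by (auto simp: ill_def positive_steps_iff)
  then show "u \<in> ?R" by blast
qed

text \<open>A Borel image would have a Borel preimage under the continuous map; by injectivity,
  which \<open>dec\<close> supplies, that preimage is \<open>ill\<close>.\<close>

lemma baire_to_real_ill_not_borel: "baire_to_real ` ill \<notin> sets borel"
proof
  obtain dec :: "real \<Rightarrow> nat \<Rightarrow> nat" where dec: "\<And>y. dec (baire_to_real y) = y"
    using baire_decoding by metis
  assume "baire_to_real ` ill \<in> sets borel"
  then have "baire_to_real -` (baire_to_real ` ill) \<in> sets borel"
    using measurable_sets[OF borel_measurable_continuous_onI[OF continuous_on_baire_to_real]] by simp
  moreover have "baire_to_real -` (baire_to_real ` ill) = ill"
    using dec by (auto, metis)
  ultimately show False using ill_not_borel by simp
qed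

theorem theorem2p8:
  shows
    "(\<exists>F :: (nat \<Rightarrow> nat) \<Rightarrow> (nat \<Rightarrow> nat) set.
        multifunction cantor_space baire_space F \<and>
        (\<forall>x\<in>mspace cantor_space. closedin (mtopology_of baire_space) (F x)) \<and>
        borel_in (prod_topology (mtopology_of cantor_space) (mtopology_of baire_space))
          (graph_of cantor_space F) \<and>
        analytic_in (mtopology_of cantor_space) (continuity_points cantor_space baire_space F) \<and>
        \<not> borel_in (mtopology_of cantor_space) (continuity_points cantor_space baire_space F))
     \<and>
     (\<exists>F :: real \<Rightarrow> real set.
        multifunction unit_interval unit_interval F \<and>
        borel_in (prod_topology (mtopology_of unit_interval) (mtopology_of unit_interval))
          (graph_of unit_interval F) \<and>
        analytic_in (mtopology_of unit_interval) (continuity_points unit_interval unit_interval F) \<and>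
        \<not> borel_in (mtopology_of unit_interval) (continuity_points unit_interval unit_interval F))"
proof (intro conjI)
  have prod_baire: "prod_topology (mtopology_of cantor_space) (mtopology_of baire_space) =
      top_of_set (cantor \<times> UNIV)"
    using prod_topology_subtopology_eu[of cantor "UNIV :: (nat \<Rightarrow> nat) set"]
    by (simp add: mtopology_of_cantor_space)
  have "multifunction cantor_space baire_space cantor_multi"
    by (simp add: multifunction_def cantor_multi_nonempty)
  moreover have "\<forall>x\<in>mspace cantor_space. closedin (mtopology_of baire_space) (cantor_multi x)"
    by (simp add: closed_cantor_multi)
  moreover have "borel_in (prod_topology (mtopology_of cantor_space) (mtopology_of baire_space))
      (graph_of cantor_space cantor_multi)"
    unfolding prod_baire borel_in_top_of_set_iff[OF closed_Times[OF closed_cantor closed_UNIV]]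
    using borel_graph_cantor_multi by (auto simp only: graph_of_def mspace_cantor_space)
  moreover have "analytic_in (mtopology_of cantor_space)
      (continuity_points cantor_space baire_space cantor_multi)"
    using analytic_image_ill[OF closed_cantor continuous_on_id, of cantor]
    unfolding continuity_points_cantor_multi mtopology_of_cantor_space by simp
  moreover have "\<not> borel_in (mtopology_of cantor_space)
      (continuity_points cantor_space baire_space cantor_multi)"
    unfolding continuity_points_cantor_multi mtopology_of_cantor_space
      borel_in_top_of_set_iff[OF closed_cantor]
    using cantor_ill_not_borel by blast
  ultimately show "\<exists>F :: (nat \<Rightarrow> nat) \<Rightarrow> (nat \<Rightarrow> nat) set.
        multifunction cantor_space baire_space F \<and>
        (\<forall>x\<in>mspace cantor_space. closedin (mtopology_of baire_space) (F x)) \<and>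
        borel_in (prod_topology (mtopology_of cantor_space) (mtopology_of baire_space))
          (graph_of cantor_space F) \<and>
        analytic_in (mtopology_of cantor_space) (continuity_points cantor_space baire_space F) \<and>
        \<not> borel_in (mtopology_of cantor_space) (continuity_points cantor_space baire_space F)"
    by blast
next
  obtain dec where dec: "dec \<in> borel_measurable borel" "\<And>y. dec (baire_to_real y) = y"
    using baire_decoding by blast
  let ?F = "interval_multi dec"
  have "multifunction unit_interval unit_interval ?F"
    using baire_to_real_bounds interval_multi_nonempty
    by (auto simp: multifunction_def mspace_unit_interval interval_multi_def)
  moreover from this have "borel_in (prod_topology (mtopology_of unit_interval) (mtopology_of unit_interval))
      (graph_of unit_interval ?F)"
    unfolding mtopology_of_unit_interval prod_topology_subtopology_eu
      borel_in_top_of_set_iff[OF closed_Times[OF closed_atLeastAtMost closed_atLeastAtMost]]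
    using borel_graph_interval_multi[OF dec]
    by (auto simp only: graph_of_def multifunction_def mspace_unit_interval)
  moreover have "analytic_in (mtopology_of unit_interval)
      (continuity_points unit_interval unit_interval ?F)"
  proof -
    have "baire_to_real ` (UNIV \<inter> ill) \<subseteq> {0..1}" using baire_to_real_bounds by blast
    from analytic_image_ill[OF closed_UNIV continuous_on_baire_to_real this] show ?thesis
      unfolding continuity_points_interval_multi[OF dec(2)] mtopology_of_unit_interval by simp
  qed
  moreover have "\<not> borel_in (mtopology_of unit_interval)
      (continuity_points unit_interval unit_interval ?F)"
    unfolding continuity_points_interval_multi[OF dec(2)] mtopology_of_unit_interval
    using baire_to_real_ill_not_borel by (simp add: borel_in_top_of_set_iff)
  ultimately show "\<exists>F :: real \<Rightarrow> real set.
        multifunction unit_interval unit_interval F \<and>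
        borel_in (prod_topology (mtopology_of unit_interval) (mtopology_of unit_interval))
          (graph_of unit_interval F) \<and>
        analytic_in (mtopology_of unit_interval) (continuity_points unit_interval unit_interval F) \<and>
        \<not> borel_in (mtopology_of unit_interval) (continuity_points unit_interval unit_interval F)"
    by blast
qed

end
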